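(* For a sequence $a=(a_k)_{k\ge1}$ in $\mathbb{C}(G)$ put $R_k={}_G\sum_{j=k+1}^\infty a_j$. (i) If $D_1=\left\{a=(a_k): {}_G\sum_{k=1}^\infty e^k\odot|a_k|^G<\infty\right\}$, then $\left(sl_\infty^G(\Delta_G)\right)^\alpha=D_1$. (ii) If $D_2=\left\{a=(a_k): {}_G\sum_{k=1}^\infty e^k\odot a_k \text{ is convergent and } {}_G\sum_{k=1}^\infty|R_k|^G<\infty\right\}$, then $\left(sl_\infty^G(\Delta_G)\right)^\beta=D_2$. (iii) If $D_3=\left\{a=(a_k): \sup_n\left|{}_G\sum_{k=1}^n e^k\odot a_k\right|^G<\infty,\ {}_G\sum_{k=1}^\infty|R_k|^G<\infty\right\}$, then $\left(sl_\infty^G(\Delta_G)\right)^\gamma=D_3$.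
   Context: Geometric complex numbers: $\mathbb{C}(G)=\{e^z: z\in\mathbb{C}\}$, where the generator $z\mapsto e^z$ is treated as a bijection from $\mathbb{C}$ onto $\mathbb{C}(G)$ with inverse $\ln$ (so an element of $\mathbb{C}(G)$ determines its exponent $z$). Operations: $e^z\oplus e^w=e^{z+w}$, $e^z\ominus e^w=e^{z-w}$, $e^z\odot e^w=e^{zw}$. $(\mathbb{C}(G),\oplus,\odot)$ is a field with geometric zero $1=e^0$ and geometric identity $e=e^1$. Geometric modulus: $|e^z|^G=e^{|z|}$, a real number $\ge 1$. On real numbers of the form $e^t$ ($t\in\mathbb{R}$) the order and suprema are the usual ones. ${}_G\sum$ denotes the geometric sum, ${}_G\sum_{k=1}^n e^{z_k}=e^{z_1+\dots+z_n}$; ${}_G\sum_{k=1}^\infty e^{z_k}$ is convergent with value $e^S$ iff $\sum_k z_k$ converges to $S$ in $\mathbb{C}$. For terms that are real and $\ge1$, ${}_G\sum<\infty$ means convergence. Conditions involving $R_k$ include that the series defining $R_k$ converges. $\omega(G)$ is the set of all sequences $(x_k)_{k\ge1}$ in $\mathbb{C}(G)$. $l_\infty^G=\{x\in\omega(G): \sup_k|x_k|^G<\infty\}$; $\Delta_G x=(x_k\ominus x_{k+1})_{k\ge1}$; $l_\infty^G(\Delta_G)=\{x\in\omega(G):\Delta_G x\in l_\infty^G\}$; $sl_\infty^G(\Delta_G)=\{x=(x_k)\in l_\infty^G(\Delta_G): x_1=1\}$. For a set $X\subset\omega(G)$ of sequences the duals (in the geometric sense) are: $X^\alpha=\{a\in\omega(G):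 {}_G\sum_{k=1}^\infty|a_k\odot x_k|^G<\infty\text{ for each }x\in X\}$; $X^\beta=\{a\in\omega(G): {}_G\sum_{k=1}^\infty a_k\odot x_k\text{ is convergent for each }x\in X\}$; $X^\gamma=\{a\in\omega(G): \sup_n|{}_G\sum_{k=1}^n a_k\odot x_k|^G<\infty\text{ for each }x\in X\}$. *)

theory Defs
  imports Complex_Main "HOL-Library.FuncSet"
begin

(* GExp z stands for the geometric complex number e^z.  The generator is required to be
   a bijection although the complex exponential is not injective, so geometric complex
   numbers form a separate copy of the complex numbers in which an element determines
   its exponent; gln is the inverse of the generator. *)
datatype gcomplex = GExp (gln: complex)

definition gadd :: "gcomplex \<Rightarrow> gcomplex \<Rightarrow> gcomplex" (infixl "\<oplus>" 65) where
  "x \<oplus> y = GExp (gln x + gln y)"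

definition gdiff :: "gcomplex \<Rightarrow> gcomplex \<Rightarrow> gcomplex" (infixl "\<ominus>" 65) where
  "x \<ominus> y = GExp (gln x - gln y)"

definition gmult :: "gcomplex \<Rightarrow> gcomplex \<Rightarrow> gcomplex" (infixl "\<odot>" 70) where
  "x \<odot> y = GExp (gln x * gln y)"

(* The geometric zero is the number 1 = e^0. *)
definition gzero :: gcomplex where
  "gzero = GExp 0"

definition gmod :: "gcomplex \<Rightarrow> real" where
  "gmod x = exp (cmod (gln x))"

(* A positive real r is the geometric complex number with the real exponent ln r;
   this is used only for r > 0. *)
definition gcomplex_of_real :: "real \<Rightarrow> gcomplex" where
  "gcomplex_of_real r = GExp (complex_of_real (ln r))"

lemma gln_gcomplex_of_real_gmod:
  "gln (gcomplex_of_real (gmod x)) = complex_of_real (cmod (gln x))"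
  by (simp add: gcomplex_of_real_def gmod_def)

definition gsum :: "(nat \<Rightarrow> gcomplex) \<Rightarrow> nat set \<Rightarrow> gcomplex" where
  "gsum f A = GExp (\<Sum>k\<in>A. gln (f k))"

lemma gsum_empty: "gsum f {} = gzero"
  by (simp add: gsum_def gzero_def)

lemma gsum_insert:
  assumes "finite A" "k \<notin> A"
  shows "gsum f (insert k A) = f k \<oplus> gsum f A"
  using assms by (simp add: gsum_def gadd_def)

(* gsums f m s: the geometric series of the terms f m, f (m + 1), ... converges to s. *)
definition gsums :: "(nat \<Rightarrow> gcomplex) \<Rightarrow> nat \<Rightarrow> gcomplex \<Rightarrow> bool" where
  "gsums f m s \<longleftrightarrow> (\<lambda>i. gln (f (m + i))) sums gln s"

definition gsummable :: "(nat \<Rightarrow> gcomplex) \<Rightarrow> nat \<Rightarrow> bool" where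
  "gsummable f m \<longleftrightarrow> (\<exists>s. gsums f m s)"

definition gsuminf :: "(nat \<Rightarrow> gcomplex) \<Rightarrow> nat \<Rightarrow> gcomplex" where
  "gsuminf f m = (THE s. gsums f m s)"

lemma gsuminf_eq: "gsums f m s \<Longrightarrow> gsuminf f m = s"
  unfolding gsuminf_def gsums_def
  by (rule the_equality) (auto intro: gcomplex.expand sums_unique2)

(* Sequences are indexed by k >= 1.  They are functions on nat restricted to {1..}
   (the value at 0 is undefined), so that equality of sequences is equality of all
   terms with index k >= 1. *)
definition omega_G :: "(nat \<Rightarrow> gcomplex) set" where
  "omega_G = {1..} \<rightarrow>\<^sub>E UNIV"

(* A supremum of reals being finite is expressed as boundedness above. *)
definition linf_G :: "(nat \<Rightarrow> gcomplex) set" where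
  "linf_G = {x \<in> omega_G. bdd_above ((\<lambda>k. gmod (x k)) ` {1..})}"

definition Delta_G :: "(nat \<Rightarrow> gcomplex) \<Rightarrow> nat \<Rightarrow> gcomplex" where
  "Delta_G x = (\<lambda>k\<in>{1..}. x k \<ominus> x (k + 1))"

definition linf_Delta_G :: "(nat \<Rightarrow> gcomplex) set" where
  "linf_Delta_G = {x \<in> omega_G. Delta_G x \<in> linf_G}"

definition slinf_Delta_G :: "(nat \<Rightarrow> gcomplex) set" where
  "slinf_Delta_G = {x \<in> linf_Delta_G. x 1 = gzero}"

definition alpha_dual :: "(nat \<Rightarrow> gcomplex) set \<Rightarrow> (nat \<Rightarrow> gcomplex) set" where
  "alpha_dual X =
     {a \<in> omega_G. \<forall>x\<in>X. gsummable (\<lambda>k. gcomplex_of_real (gmod (a k \<odot> x k))) 1}"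

definition beta_dual :: "(nat \<Rightarrow> gcomplex) set \<Rightarrow> (nat \<Rightarrow> gcomplex) set" where
  "beta_dual X = {a \<in> omega_G. \<forall>x\<in>X. gsummable (\<lambda>k. a k \<odot> x k) 1}"

definition gamma_dual :: "(nat \<Rightarrow> gcomplex) set \<Rightarrow> (nat \<Rightarrow> gcomplex) set" where
  "gamma_dual X =
     {a \<in> omega_G. \<forall>x\<in>X. bdd_above ((\<lambda>n. gmod (gsum (\<lambda>k. a k \<odot> x k) {1..n})) ` {1..})}"

definition gtail :: "(nat \<Rightarrow> gcomplex) \<Rightarrow> nat \<Rightarrow> gcomplex" where
  "gtail a k = gsuminf a (k + 1)"

(* Absolute summability of the tails R_k includes the existence of every R_k. *)
definition gtail_abs_summable :: "(nat \<Rightarrow> gcomplex) \<Rightarrow> bool" where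
  "gtail_abs_summable a \<longleftrightarrow>
     (\<forall>k\<ge>1. gsummable a (k + 1)) \<and> gsummable (\<lambda>k. gcomplex_of_real (gmod (gtail a k))) 1"

end

theory Submission
  imports Defs
begin

text \<open>
  Taking exponents and shifting the index by one turns the claim into a statement about a complex
  sequence \<open>c\<close> and all multipliers \<open>w\<close> with \<open>w 0 = 0\<close> and bounded differences. For (i) the
  multiplier \<open>w i = i\<close> is extremal. For (ii) and (iii), summation by parts gives
  \<open>\<Sum>i<n. c i * w i = (\<Sum>j<n. (w (j+1) - w j) * T (j+1)) - w n * T n\<close> with the tails
  \<open>T m = \<Sum>i. c (m + i)\<close>, and the boundary term is \<open>O(n * T n)\<close>. Testing with \<open>w i = i\<close> shows that the
  partial sums of \<open>i * c i\<close> are bounded (or converge), which by partial summation against \<open>1 / i\<close>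
  makes \<open>c\<close> summable and \<open>n * T n\<close> bounded (or null). So the sums \<open>\<Sum>j. (w (j+1) - w j) * T (j+1)\<close>
  have to be bounded for all bounded differences, which means that the tails are absolutely summable.
\<close>

section \<open>Series with bounded weighted partial sums\<close>

text \<open>Abel summation against \<open>1 / i\<close>: the weights
  \<open>1 / i - 1 / (i + 1)\<close> are nonnegative and telescope, so the boundary part
  \<open>C / n\<close> and the sum part \<open>C * (1 / m - 1 / n)\<close> add up to exactly
  \<open>C / m\<close>.\<close>

lemma norm_mult_sum_le_weighted:
  fixes c :: "nat \<Rightarrow> 'a::real_normed_field"
  assumes m: "m \<ge> 1" and n: "m \<le> n"
    and bound: "\<And>k. m \<le> k \<Longrightarrow> norm (\<Sum>i=m..<k. of_nat i * c i) \<le> C"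
  shows "norm (of_nat m * (\<Sum>i=m..<n. c i)) \<le> C"
proof -
  define s where "s k = (\<Sum>i=m..<k. of_nat i * c i)" for k
  have s_le: "norm (s k) \<le> C" if "m \<le> k" for k
    using bound[OF that] by (simp add: s_def)
  \<comment> \<open>Since \<open>s k\<close> excludes the index \<open>k\<close>,
    \<open>s m = 0\<close> and no lower boundary term appears.\<close>
  have by_parts: "(\<Sum>i=m..<n. c i) =
      s n / of_nat n + (\<Sum>i=m..<n. s (Suc i) * of_real (1 / i - 1 / Suc i))"
    using n
  proof (induction n rule: dec_induct)
    case base
    show ?case by (simp add: s_def)
  next
    case (step n)
    have pos: "(of_nat n :: 'a) \<noteq> 0" "(of_nat (Suc n) :: 'a) \<noteq> 0"
      using step m by (simp_all del: of_nat_Suc)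
    have s: "s (Suc n) = s n + of_nat n * c n"
      using step by (simp add: s_def)
    have "c n = (s (Suc n) - s n) / of_nat n"
      using pos by (simp add: s)
    then have "c n = s (Suc n) / of_nat (Suc n) - s n / of_nat n
        + s (Suc n) * of_real (1 / n - 1 / Suc n)"
      by (simp add: algebra_simps diff_divide_distrib del: of_nat_Suc)
    then show ?case
      using step by simp
  qed
  have telescope: "(\<Sum>i=m..<n. 1 / real i - 1 / Suc i) = 1 / m - 1 / n"
    using sum_Suc_diff'[of m n "\<lambda>i. - (1 / real i)"] n by simp
  have "norm (\<Sum>i=m..<n. s (Suc i) * of_real (1 / i - 1 / Suc i))
      \<le> (\<Sum>i=m..<n. C * (1 / i - 1 / Suc i))"
  proof (rule sum_norm_le)
    fix i assume i: "i \<in> {m..<n}"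
    then have nonneg: "0 \<le> 1 / real i - 1 / Suc i"
      using m by (simp add: frac_le)
    have "norm (s (Suc i) * of_real (1 / i - 1 / Suc i)) = norm (s (Suc i)) * (1 / i - 1 / Suc i)"
      unfolding norm_mult norm_of_real using nonneg by simp
    also have "\<dots> \<le> C * (1 / i - 1 / Suc i)"
      using i nonneg by (intro mult_right_mono s_le) auto
    finally show "norm (s (Suc i) * of_real (1 / i - 1 / Suc i)) \<le> C * (1 / i - 1 / Suc i)" .
  qed
  also have "\<dots> = C * (1 / m - 1 / n)"
    by (simp only: sum_distrib_left[symmetric] telescope)
  finally have "norm (\<Sum>i=m..<n. c i) \<le> C / n + C * (1 / m - 1 / n)"
    unfolding by_parts using s_le[OF n]
    by (intro norm_triangle_mono) (simp_all add: norm_divide divide_right_mono)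
  also have "\<dots> = C / m"
    by (simp add: algebra_simps)
  finally show ?thesis
    using m by (simp add: norm_mult field_simps)
qed

lemma weighted_block_bound:
  fixes c :: "nat \<Rightarrow> 'a::real_normed_field"
  assumes "Bseq (\<lambda>n. \<Sum>i<n. of_nat i * c i)"
  obtains C where "C > 0" "\<And>m n. m \<le> n \<Longrightarrow> norm (of_nat m * (\<Sum>i=m..<n. c i)) \<le> C"
proof -
  obtain K where K: "K > 0" "\<And>n. norm (\<Sum>i<n. of_nat i * c i) \<le> K"
    using assms by (auto simp: Bseq_def)
  \<comment> \<open>A block is a difference of two partial sums, whence the factor 2.\<close>
  have block: "norm (\<Sum>i=m..<k. of_nat i * c i) \<le> 2 * K" if "m \<le> k" for m k
  proof -
    have "(\<Sum>i=m..<k. of_nat i * c i) = (\<Sum>i<k. of_nat i * c i) - (\<Sum>i<m. of_nat i * c i)"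
      using sum_diff_nat_ivl[of 0 m k "\<lambda>i. of_nat i * c i"] that
      by (simp add: atLeast0LessThan)
    then show ?thesis
      using norm_triangle_ineq4[of "\<Sum>i<k. of_nat i * c i" "\<Sum>i<m. of_nat i * c i"] K(2)[of k] K(2)[of m]
      by simp
  qed
  have "norm (of_nat m * (\<Sum>i=m..<n. c i)) \<le> 2 * K" if "m \<le> n" for m n
  proof (cases "m = 0")
    case True
    then show ?thesis using K(1) by simp
  next
    case False
    then show ?thesis
      using that block by (intro norm_mult_sum_le_weighted) auto
  qed
  with K(1) show thesis
    by (intro that[of "2 * K"]) auto
qed

text \<open>Blocks starting at \<open>m\<close> have norm at most \<open>C / m\<close>, so the
  partial sums are Cauchy.\<close>

lemma summable_if_Bseq_weighted:
  fixes c :: "nat \<Rightarrow> 'a::{real_normed_field,banach}"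
  assumes "Bseq (\<lambda>n. \<Sum>i<n. of_nat i * c i)"
  shows "summable c"
proof -
  obtain C where C: "C > 0" "\<And>m n. m \<le> n \<Longrightarrow> norm (of_nat m * (\<Sum>i=m..<n. c i)) \<le> C"
    using weighted_block_bound[OF assms] by blast
  show ?thesis
    unfolding summable_Cauchy
  proof (intro allI impI)
    fix e :: real assume e: "e > 0"
    obtain N :: nat where N: "C / e < N"
      using reals_Archimedean2 by blast
    have "norm (sum c {m..<n}) < e" if "m \<ge> N" for m n
    proof (cases "m \<le> n")
      case True
      have m: "C / e < m" using N that by linarith
      have pos: "real m > 0" using m divide_pos_pos[OF C(1) e] by linarith
      have "real m * norm (sum c {m..<n}) \<le> C"
        using C(2)[OF True] by (simp add: norm_mult)
      also have "C < real m * e"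
        using m e by (simp add: field_simps)
      finally show ?thesis using pos by simp
    qed (use e in simp)
    then show "\<exists>N. \<forall>m\<ge>N. \<forall>n. norm (sum c {m..<n}) < e" by blast
  qed
qed

text \<open>A bound on all finite blocks from \<open>m\<close> survives the limit \<open>n\<close>
  to infinity.\<close>

lemma norm_weighted_tail_le:
  fixes c :: "nat \<Rightarrow> 'a::{real_normed_field,banach}"
  assumes c: "summable c"
    and bound: "\<And>n. m \<le> n \<Longrightarrow> norm (of_nat m * (\<Sum>i=m..<n. c i)) \<le> C"
  shows "norm (of_nat m * (\<Sum>i. c (m + i))) \<le> C"
proof -
  have "summable (\<lambda>i. c (m + i))"
    using summable_ignore_initial_segment[OF c, of m] by (simp add: add.commute)
  then have "(\<lambda>n. norm (of_nat m * (\<Sum>i<n. c (m + i)))) \<longlonglongrightarrow> norm (of_nat m * (\<Sum>i. c (m + i)))"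
    by (intro tendsto_norm tendsto_mult tendsto_const summable_LIMSEQ)
  moreover have "norm (of_nat m * (\<Sum>i<n. c (m + i))) \<le> C" for n
    using bound[of "m + n"] sum.shift_bounds_nat_ivl[of c 0 m n]
    by (simp add: atLeast0LessThan add.commute)
  ultimately show ?thesis
    by (intro LIMSEQ_le_const2) auto
qed

lemma Bseq_weighted_tail:
  fixes c :: "nat \<Rightarrow> 'a::{real_normed_field,banach}"
  assumes "Bseq (\<lambda>n. \<Sum>i<n. of_nat i * c i)"
  shows "Bseq (\<lambda>n. of_nat n * (\<Sum>i. c (n + i)))"
proof -
  obtain C where C: "\<And>m n. m \<le> n \<Longrightarrow> norm (of_nat m * (\<Sum>i=m..<n. c i)) \<le> C"
    using weighted_block_bound[OF assms] by blast
  have "norm (of_nat n * (\<Sum>i. c (n + i))) \<le> C" for n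
    using summable_if_Bseq_weighted[OF assms] C by (rule norm_weighted_tail_le)
  then show ?thesis by (rule BseqI')
qed

text \<open>Convergence instead of mere boundedness makes the block bound arbitrarily small: by the
  Cauchy criterion it can be taken as \<open>e / 2\<close> for all late \<open>m\<close>.\<close>

lemma weighted_tail_tendsto_0:
  fixes c :: "nat \<Rightarrow> 'a::{real_normed_field,banach}"
  assumes w: "summable (\<lambda>i. of_nat i * c i)"
  shows "(\<lambda>n. of_nat n * (\<Sum>i. c (n + i))) \<longlonglongrightarrow> 0"
proof (rule LIMSEQ_I)
  fix e :: real assume e: "e > 0"
  have c: "summable c"
    using w by (intro summable_if_Bseq_weighted convergent_imp_Bseq) (simp add: summable_iff_convergent)
  obtain N where N: "\<And>m n. m \<ge> N \<Longrightarrow> norm (\<Sum>i=m..<n. of_nat i * c i) < e / 2"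
    using w e unfolding summable_Cauchy by (meson half_gt_zero)
  have "norm (of_nat m * (\<Sum>i. c (m + i)) - 0) < e" if m: "m \<ge> max 1 N" for m
  proof -
    have "norm (of_nat m * (\<Sum>i. c (m + i))) \<le> e / 2"
      using m N by (intro norm_weighted_tail_le[OF c] norm_mult_sum_le_weighted) (auto intro: less_imp_le)
    then show ?thesis using e by simp
  qed
  then show "\<exists>N. \<forall>m\<ge>N. norm (of_nat m * (\<Sum>i. c (m + i)) - 0) < e" by blast
qed

section \<open>Multipliers with bounded differences\<close>

text \<open>Induction on \<open>n\<close>, writing \<open>c n\<close> as the difference of two
  consecutive tails; \<open>w 0 = 0\<close> settles the empty sum.\<close>

lemma sum_mult_by_parts_tail:
  fixes c w :: "nat \<Rightarrow> 'a::{real_normed_field,banach}"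
  assumes c: "summable c" and w: "w 0 = 0"
  shows "(\<Sum>i<n. c i * w i) =
    (\<Sum>j<n. (w (Suc j) - w j) * (\<Sum>i. c (Suc j + i))) - w n * (\<Sum>i. c (n + i))"
proof (induction n)
  case (Suc n)
  have "summable (\<lambda>i. c (n + i))"
    using summable_ignore_initial_segment[OF c, of n] by (simp add: add.commute)
  from suminf_split_head[OF this] have "c n = (\<Sum>i. c (n + i)) - (\<Sum>i. c (Suc n + i))"
    by simp
  then have "c n * w n = w n * (\<Sum>i. c (n + i)) - w n * (\<Sum>i. c (Suc n + i))"
    by (simp only: left_diff_distrib right_diff_distrib mult.commute)
  then show ?case
    unfolding sum.lessThan_Suc Suc.IH by (simp only: left_diff_distrib) simp
qed (simp add: w)

text \<open>The exponents of \<open>slinf_Delta_G\<close> with the index shifted down by one: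
  \<open>w i\<close> is the exponent of the term with index \<open>i + 1\<close>, so the condition
  that the first term is the geometric zero becomes \<open>w 0 = 0\<close>.\<close>

definition lipschitz_multipliers :: "(nat \<Rightarrow> complex) set" where
  "lipschitz_multipliers = {w. w 0 = 0 \<and> Bseq (\<lambda>i. w (Suc i) - w i)}"

lemma of_nat_mem_lipschitz_multipliers: "of_nat \<in> lipschitz_multipliers"
  by (simp add: lipschitz_multipliers_def Bseq_def exI[of _ 1])

lemma lipschitz_multipliers_0: "w \<in> lipschitz_multipliers \<Longrightarrow> w 0 = 0"
  by (simp add: lipschitz_multipliers_def)

lemma lipschitz_multipliers_bounded:
  assumes "w \<in> lipschitz_multipliers"
  shows "\<exists>C>0. \<forall>i. norm (w (Suc i) - w i) \<le> C \<and> norm (w i) \<le> C * real i"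
proof -
  obtain C where C: "C > 0" "w 0 = 0" "\<And>i. norm (w (Suc i) - w i) \<le> C"
    using assms by (auto simp: lipschitz_multipliers_def Bseq_def)
  have "norm (w i) \<le> C * real i" for i
  proof (induction i)
    case (Suc i)
    then show ?case
      using norm_triangle_sub[of "w (Suc i)" "w i"] C(3)[of i] by (simp add: algebra_simps)
  qed (simp add: C)
  with C show ?thesis by blast
qed

lemma norm_lipschitz_mult_le:
  fixes w :: "nat \<Rightarrow> complex"
  assumes "\<And>i. norm (w i) \<le> C * real i"
  shows "norm (w n * t) \<le> norm (of_nat n * t) * C"
  using mult_right_mono[OF assms[of n], of "norm t"] by (simp add: norm_mult mult_ac)

text \<open>Only the increments of \<open>w\<close> are constrained, so they can be prescribed as
  the conjugate signs of \<open>r\<close>, which have norm at most 1. This converts bounded sums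
  into absolute summability.\<close>

lemma sgn_multiplier:
  fixes r :: "nat \<Rightarrow> complex"
  obtains w where "w \<in> lipschitz_multipliers"
    "\<And>j. (w (Suc j) - w j) * r j = complex_of_real (norm (r j))"
proof
  let ?w = "\<lambda>n. \<Sum>j<n. cnj (sgn (r j))"
  show "?w \<in> lipschitz_multipliers"
    by (auto simp: lipschitz_multipliers_def norm_sgn intro!: BseqI'[where K = 1])
  show "(?w (Suc j) - ?w j) * r j = complex_of_real (norm (r j))" for j
    by (simp add: sgn_eq complex_norm_square[symmetric] power2_eq_square mult.commute)
qed

lemma summable_norm_iff_Bseq:
  fixes f :: "nat \<Rightarrow> 'a::real_normed_vector"
  shows "summable (\<lambda>i. norm (f i)) \<longleftrightarrow> Bseq (\<lambda>n. \<Sum>i<n. norm (f i))"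
proof
  assume "Bseq (\<lambda>n. \<Sum>i<n. norm (f i))"
  then obtain K where "\<And>n. norm (\<Sum>i<n. norm (f i)) \<le> K"
    by (auto simp: Bseq_def)
  then show "summable (\<lambda>i. norm (f i))"
    by (intro summableI_nonneg_bounded[where x = K]) (auto simp: abs_le_iff)
qed (simp add: summable_iff_convergent convergent_imp_Bseq)

section \<open>Alpha dual of the multipliers\<close>

lemma alpha_dual_lipschitz:
  fixes c :: "nat \<Rightarrow> complex"
  shows "(\<forall>w\<in>lipschitz_multipliers. summable (\<lambda>i. norm (c i * w i))) \<longleftrightarrow>
    summable (\<lambda>i. real (Suc i) * norm (c i))"
proof
  assume "\<forall>w\<in>lipschitz_multipliers. summable (\<lambda>i. norm (c i * w i))"
  then have "summable (\<lambda>i. norm (c i * of_nat i))"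
    using of_nat_mem_lipschitz_multipliers by blast
  then have "summable (\<lambda>i. 2 * norm (c i * of_nat i))"
    by (rule summable_mult)
  \<comment> \<open>The multiplier \<open>of_nat\<close> vanishes at 0, so the comparison starts at
    1, where \<open>i + 1 \<le> 2 * i\<close>.\<close>
  moreover have "\<forall>i\<ge>1. norm (real (Suc i) * norm (c i)) \<le> 2 * norm (c i * of_nat i)"
  proof (intro allI impI)
    fix i :: nat assume "i \<ge> 1"
    then have "real (Suc i) * norm (c i) \<le> (2 * real i) * norm (c i)"
      by (intro mult_right_mono) auto
    then show "norm (real (Suc i) * norm (c i)) \<le> 2 * norm (c i * of_nat i)"
      by (simp add: norm_mult mult_ac)
  qed
  ultimately show "summable (\<lambda>i. real (Suc i) * norm (c i))"
    by (intro summable_comparison_test[of "\<lambda>i. real (Suc i) * norm (c i)"] exI[of _ 1])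
next
  assume s: "summable (\<lambda>i. real (Suc i) * norm (c i))"
  show "\<forall>w\<in>lipschitz_multipliers. summable (\<lambda>i. norm (c i * w i))"
  proof
    fix w assume w: "w \<in> lipschitz_multipliers"
    obtain C where C: "C > 0" "\<And>i. norm (w i) \<le> C * real i"
      using lipschitz_multipliers_bounded[OF w] by blast
    have "norm (norm (c i * w i)) \<le> C * (real (Suc i) * norm (c i))" for i
    proof -
      have "norm (w i) \<le> C * real (Suc i)"
        using C(2)[of i] C(1) by (simp add: algebra_simps)
      from mult_right_mono[OF this, of "norm (c i)"] show ?thesis
        by (simp add: norm_mult mult_ac)
    qed
    then show "summable (\<lambda>i. norm (c i * w i))"
      by (intro summable_comparison_test[OF _ summable_mult[OF s, of C]]) auto
  qed
qed

section \<open>Gamma and beta duals of the multipliers\<close>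

lemma Bseq_add_Bseq:
  fixes f g :: "nat \<Rightarrow> 'a::real_normed_vector"
  assumes "Bseq f" "Bseq g"
  shows "Bseq (\<lambda>n. f n + g n)"
proof -
  obtain K L where "\<And>n. norm (f n) \<le> K" "\<And>n. norm (g n) \<le> L"
    using assms by (auto simp: Bseq_def)
  then show ?thesis
    by (intro BseqI'[where K = "K + L"] norm_triangle_mono)
qed

lemma Bseq_diff_Bseq:
  fixes f g :: "nat \<Rightarrow> 'a::real_normed_vector"
  assumes "Bseq f" "Bseq g"
  shows "Bseq (\<lambda>n. f n - g n)"
  using Bseq_add_Bseq[of f "\<lambda>n. - g n"] assms by (simp add: Bseq_minus_iff)

lemma summable_imp_Bseq_sum:
  "summable f \<Longrightarrow> Bseq (\<lambda>n. \<Sum>i<n. f i)" for f :: "nat \<Rightarrow> 'a::real_normed_vector"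
  by (simp add: summable_iff_convergent convergent_imp_Bseq)

text \<open>Controls the boundary term of the summation by parts: \<open>w\<close> grows at most
  linearly, and \<open>n\<close> times the tail from \<open>n\<close> is bounded.\<close>

lemma Bseq_lipschitz_mult_tail:
  assumes "Bseq (\<lambda>n. \<Sum>i<n. of_nat i * c i)" and w: "w \<in> lipschitz_multipliers"
  shows "Bseq (\<lambda>n. w n * (\<Sum>i. c (n + i)))"
proof -
  obtain C where C: "C > 0" "\<And>i. norm (w i) \<le> C * real i"
    using lipschitz_multipliers_bounded[OF w] by blast
  obtain K where "\<And>n. norm (of_nat n * (\<Sum>i. c (n + i))) \<le> K"
    using Bseq_weighted_tail[OF assms(1)] by (auto simp: Bseq_def)
  then have "norm (w n * (\<Sum>i. c (n + i))) \<le> K * C" for n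
    using C(1) by (intro order_trans[OF norm_lipschitz_mult_le[OF C(2)]] mult_right_mono) auto
  then show ?thesis by (rule BseqI')
qed

lemma lipschitz_mult_tail_tendsto_0:
  assumes "summable (\<lambda>i. of_nat i * c i)" and w: "w \<in> lipschitz_multipliers"
  shows "(\<lambda>n. w n * (\<Sum>i. c (n + i))) \<longlonglongrightarrow> 0"
proof -
  obtain C where C: "\<And>i. norm (w i) \<le> C * real i"
    using lipschitz_multipliers_bounded[OF w] by blast
  from norm_lipschitz_mult_le[OF C] show ?thesis
    by (intro tendsto_0_le[OF weighted_tail_tendsto_0[OF assms(1)], of _ C] always_eventually allI)
qed

lemma summable_lipschitz_diff_mult:
  assumes r: "summable (\<lambda>j. norm (r j))" and w: "w \<in> lipschitz_multipliers"
  shows "summable (\<lambda>j. (w (Suc j) - w j) * r j)"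
proof -
  obtain C where C: "\<And>i. norm (w (Suc i) - w i) \<le> C"
    using lipschitz_multipliers_bounded[OF w] by blast
  have "norm ((w (Suc j) - w j) * r j) \<le> C * norm (r j)" for j
    unfolding norm_mult by (intro mult_right_mono C) auto
  then show ?thesis
    by (intro summable_comparison_test[OF _ summable_mult[OF r, of C]]) auto
qed

text \<open>With \<open>c i\<close> the exponent of the term of index \<open>i + 1\<close>, the
  weight \<open>Suc i\<close> is that index, and the tail from \<open>Suc j\<close> is the exponent
  of \<open>R_k\<close> for \<open>k = j + 1\<close>.\<close>

lemma gamma_dual_lipschitz:
  fixes c :: "nat \<Rightarrow> complex"
  shows "(\<forall>w\<in>lipschitz_multipliers. Bseq (\<lambda>n. \<Sum>i<n. c i * w i)) \<longleftrightarrow>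
    Bseq (\<lambda>n. \<Sum>i<n. of_nat (Suc i) * c i) \<and> summable c \<and>
    summable (\<lambda>j. norm (\<Sum>i. c (Suc j + i)))" (is "?L \<longleftrightarrow> ?R")
proof
  assume L: ?L
  then have "Bseq (\<lambda>n. \<Sum>i<n. c i * of_nat i)"
    using of_nat_mem_lipschitz_multipliers by blast
  then have id: "Bseq (\<lambda>n. \<Sum>i<n. of_nat i * c i)"
    by (simp add: mult.commute)
  then have c: "summable c"
    by (rule summable_if_Bseq_weighted)
  obtain w where w: "w \<in> lipschitz_multipliers"
    "\<And>j. (w (Suc j) - w j) * (\<Sum>i. c (Suc j + i)) = complex_of_real (norm (\<Sum>i. c (Suc j + i)))"
    using sgn_multiplier[of "\<lambda>j. \<Sum>i. c (Suc j + i)"] by blast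
  have w0: "w 0 = 0"
    using w(1) by (rule lipschitz_multipliers_0)
  \<comment> \<open>Adding the boundary term back leaves exactly the partial sums of the norms of
    the tails, by the choice of \<open>w\<close>.\<close>
  have "Bseq (\<lambda>n. (\<Sum>i<n. c i * w i) + w n * (\<Sum>i. c (n + i)))"
    using L w(1) id by (intro Bseq_add_Bseq Bseq_lipschitz_mult_tail) auto
  then have "Bseq (\<lambda>n. complex_of_real (\<Sum>j<n. norm (\<Sum>i. c (Suc j + i))))"
    by (simp only: sum_mult_by_parts_tail[OF c, of w, OF w0] w(2) diff_add_cancel of_real_sum)
  then have "Bseq (\<lambda>n. \<Sum>j<n. norm (\<Sum>i. c (Suc j + i)))"
    by (simp only: Bseq_def norm_of_real real_norm_def)
  moreover have "Bseq (\<lambda>n. \<Sum>i<n. of_nat (Suc i) * c i)"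
    using Bseq_add_Bseq[OF summable_imp_Bseq_sum[OF c] id] by (simp add: sum.distrib algebra_simps)
  ultimately show ?R
    using c by (simp only: summable_norm_iff_Bseq simp_thms)
next
  assume R: ?R
  then have c: "summable c" by blast
  have id: "Bseq (\<lambda>n. \<Sum>i<n. of_nat i * c i)"
    using Bseq_diff_Bseq[OF _ summable_imp_Bseq_sum[OF c], of "\<lambda>n. \<Sum>i<n. of_nat (Suc i) * c i"] R
    by (simp add: sum.distrib algebra_simps)
  show ?L
  proof
    fix w assume w: "w \<in> lipschitz_multipliers"
    have w0: "w 0 = 0"
      using w by (rule lipschitz_multipliers_0)
    show "Bseq (\<lambda>n. \<Sum>i<n. c i * w i)"
      unfolding sum_mult_by_parts_tail[OF c, of w, OF w0]
      using R w id
      by (intro Bseq_diff_Bseq[OF summable_imp_Bseq_sum[OF summable_lipschitz_diff_mult]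
            Bseq_lipschitz_mult_tail]) auto
  qed
qed

lemma beta_dual_lipschitz:
  fixes c :: "nat \<Rightarrow> complex"
  shows "(\<forall>w\<in>lipschitz_multipliers. summable (\<lambda>i. c i * w i)) \<longleftrightarrow>
    summable (\<lambda>i. of_nat (Suc i) * c i) \<and> summable c \<and>
    summable (\<lambda>j. norm (\<Sum>i. c (Suc j + i)))" (is "?L \<longleftrightarrow> ?R")
proof
  assume L: ?L
  \<comment> \<open>Convergent partial sums are bounded, so the gamma case already yields both tail
    conditions.\<close>
  then have "\<forall>w\<in>lipschitz_multipliers. Bseq (\<lambda>n. \<Sum>i<n. c i * w i)"
    using summable_imp_Bseq_sum by blast
  then have c: "summable c" and tails: "summable (\<lambda>j. norm (\<Sum>i. c (Suc j + i)))"
    by (simp_all only: gamma_dual_lipschitz)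
  have "summable (\<lambda>i. c i * of_nat i)"
    using L of_nat_mem_lipschitz_multipliers by blast
  from summable_add[OF c this] show ?R
    using c tails by (simp add: algebra_simps)
next
  assume R: ?R
  then have c: "summable c" by blast
  have id: "summable (\<lambda>i. of_nat i * c i)"
    using summable_diff[OF _ c, of "\<lambda>i. of_nat (Suc i) * c i"] R by (simp add: algebra_simps)
  show ?L
  proof
    fix w assume w: "w \<in> lipschitz_multipliers"
    have w0: "w 0 = 0"
      using w by (rule lipschitz_multipliers_0)
    have "convergent (\<lambda>n. w n * (\<Sum>i. c (n + i)))"
      using lipschitz_mult_tail_tendsto_0[OF id w] by (rule convergentI)
    moreover have "convergent (\<lambda>n. \<Sum>j<n. (w (Suc j) - w j) * (\<Sum>i. c (Suc j + i)))"
      unfolding summable_iff_convergent[symmetric]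
      using R w by (intro summable_lipschitz_diff_mult) auto
    ultimately show "summable (\<lambda>i. c i * w i)"
      unfolding summable_iff_convergent sum_mult_by_parts_tail[OF c, of w, OF w0]
      by (intro convergent_diff)
  qed
qed

section \<open>Exponents of geometric sequences\<close>

lemma gsummable_iff: "gsummable f m \<longleftrightarrow> summable (\<lambda>i. gln (f (m + i)))"
  unfolding gsummable_def gsums_def summable_def by (metis gcomplex.sel)

lemma gln_gsuminf:
  assumes "gsummable f m"
  shows "gln (gsuminf f m) = (\<Sum>i. gln (f (m + i)))"
  using assms unfolding gsummable_def by (metis gsuminf_eq gsums_def sums_unique)

lemma bdd_above_gmod_iff: "bdd_above ((\<lambda>n. gmod (f n)) ` {1..}) \<longleftrightarrow> Bseq (\<lambda>n. gln (f (Suc n)))"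
proof -
  have "bdd_above ((\<lambda>n. gmod (f n)) ` {1..}) \<longleftrightarrow> (\<exists>K. \<forall>n. gmod (f (Suc n)) \<le> K)"
    by (auto simp: bdd_above_def) (metis Suc_le_D atLeast_iff)
  also have "\<dots> \<longleftrightarrow> (\<exists>K>0. \<forall>n. gmod (f (Suc n)) \<le> exp K)"
  proof safe
    fix K assume K: "\<forall>n. gmod (f (Suc n)) \<le> K"
    \<comment> \<open>Uses \<open>1 + t \<le> exp t\<close>; the summand 1 makes the exponent
      strictly positive, as \<open>Bseq\<close> demands.\<close>
    have "gmod (f (Suc n)) \<le> exp (\<bar>K\<bar> + 1)" for n
      using K[rule_format, of n] exp_ge_add_one_self[of "\<bar>K\<bar> + 1"] by linarith
    then show "\<exists>K>0. \<forall>n. gmod (f (Suc n)) \<le> exp K"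
      by (intro exI[of _ "\<bar>K\<bar> + 1"]) auto
  qed auto
  finally show ?thesis
    by (simp add: Bseq_def gmod_def)
qed

lemma gtail_abs_summable_iff:
  "gtail_abs_summable a \<longleftrightarrow> summable (\<lambda>i. gln (a (Suc i))) \<and>
     summable (\<lambda>j. norm (\<Sum>i. gln (a (Suc (Suc j + i)))))"
proof -
  have tails: "(\<forall>k\<ge>1. gsummable a (k + 1)) \<longleftrightarrow> summable (\<lambda>i. gln (a (Suc i)))"
  proof -
    have "gsummable a (k + 1) \<longleftrightarrow> summable (\<lambda>i. gln (a (Suc i)))" for k
      unfolding gsummable_iff
      using summable_iff_shift[of "\<lambda>i. gln (a (Suc i))" k] by (simp add: add.commute)
    then show ?thesis by auto
  qed
  show ?thesis
  \<comment> \<open>\<open>gtail\<close> has its intended value only where the tail series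
    converges. If some tail fails to converge, both sides are false.\<close>
  proof (cases "\<forall>k\<ge>1. gsummable a (k + 1)")
    case True
    then have "gln (gtail a (Suc j)) = (\<Sum>i. gln (a (Suc (Suc j + i))))" for j
      by (simp add: gtail_def gln_gsuminf)
    with True tails show ?thesis
      by (simp add: gtail_abs_summable_def gsummable_iff gln_gcomplex_of_real_gmod)
  next
    case False
    with tails show ?thesis
      by (simp only: gtail_abs_summable_def simp_thms)
  qed
qed

lemma mem_slinf_Delta_G_iff:
  "x \<in> slinf_Delta_G \<longleftrightarrow> x \<in> omega_G \<and> (\<lambda>i. gln (x (Suc i))) \<in> lipschitz_multipliers"
proof -
  have "(\<lambda>k. gmod (Delta_G x k)) ` {1..} = (\<lambda>k. gmod (x k \<ominus> x (Suc k))) ` {1..}"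
    by (intro image_cong) (auto simp: Delta_G_def)
  then have "Delta_G x \<in> linf_G \<longleftrightarrow> Bseq (\<lambda>i. gln (x (Suc i)) - gln (x (Suc (Suc i))))"
    by (simp add: linf_G_def bdd_above_gmod_iff omega_G_def Delta_G_def gdiff_def
        del: One_nat_def flip: Suc_eq_plus1)
  \<comment> \<open>\<open>Delta_G\<close> takes differences with the sign opposite to that of the
    multipliers.\<close>
  also have "\<dots> \<longleftrightarrow> Bseq (\<lambda>i. gln (x (Suc (Suc i))) - gln (x (Suc i)))"
    by (simp add: Bseq_def norm_minus_commute)
  finally show ?thesis
    by (auto simp: slinf_Delta_G_def linf_Delta_G_def lipschitz_multipliers_def gzero_def gcomplex.expand)
qed

text \<open>Every multiplier is the exponent sequence of some member of
  \<open>slinf_Delta_G\<close>, so each dual becomes a condition over all multipliers.\<close>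

lemma ball_slinf_Delta_G_iff:
  "(\<forall>x\<in>slinf_Delta_G. P (\<lambda>i. gln (x (Suc i)))) \<longleftrightarrow> (\<forall>w\<in>lipschitz_multipliers. P w)"
proof safe
  fix w assume P: "\<forall>x\<in>slinf_Delta_G. P (\<lambda>i. gln (x (Suc i)))" and w: "w \<in> lipschitz_multipliers"
  \<comment> \<open>The restriction to \<open>{1..}\<close> leaves \<open>x 0\<close> undefined, as
    membership in \<open>omega_G\<close> requires.\<close>
  define x where "x = (\<lambda>k\<in>{1..}. GExp (w (k - 1)))"
  have "(\<lambda>i. gln (x (Suc i))) = w"
    by (simp add: x_def)
  moreover have "x \<in> omega_G"
    by (simp add: x_def omega_G_def)
  ultimately show "P w"
    using P w by (metis mem_slinf_Delta_G_iff)
qed (simp add: mem_slinf_Delta_G_iff)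

lemma bdd_above_gmod_gsum_iff:
  "bdd_above ((\<lambda>n. gmod (gsum f {1..n})) ` {1..}) \<longleftrightarrow> Bseq (\<lambda>n. \<Sum>i<n. gln (f (Suc i)))"
  \<comment> \<open>The supremum runs over \<open>n \<ge> 1\<close>; including the empty sum at
    \<open>n = 0\<close> does not affect boundedness.\<close>
  unfolding bdd_above_gmod_iff Bseq_Suc_iff[of "\<lambda>n. gln (gsum f {1..n})"]
  by (simp add: gsum_def sum.atLeast1_atMost_eq)

theorem theorem4p1:
  "alpha_dual slinf_Delta_G =
     {a \<in> omega_G. gsummable (\<lambda>k. GExp (of_nat k) \<odot> gcomplex_of_real (gmod (a k))) 1} \<and>
   beta_dual slinf_Delta_G =
     {a \<in> omega_G. gsummable (\<lambda>k. GExp (of_nat k) \<odot> a k) 1 \<and> gtail_abs_summable a} \<and>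
   gamma_dual slinf_Delta_G =
     {a \<in> omega_G. bdd_above ((\<lambda>n. gmod (gsum (\<lambda>k. GExp (of_nat k) \<odot> a k) {1..n})) ` {1..}) \<and>
        gtail_abs_summable a}"
proof (intro conjI set_eqI)
  fix a
  show "a \<in> alpha_dual slinf_Delta_G \<longleftrightarrow>
    a \<in> {a \<in> omega_G. gsummable (\<lambda>k. GExp (of_nat k) \<odot> gcomplex_of_real (gmod (a k))) 1}"
    \<comment> \<open>Geometric series of moduli have real exponents embedded in the complex
      numbers; \<open>summable_complex_of_real\<close> returns to real series.\<close>
    using ball_slinf_Delta_G_iff[of "\<lambda>w. summable (\<lambda>i. norm (gln (a (Suc i)) * w i))"]
      alpha_dual_lipschitz[of "\<lambda>i. gln (a (Suc i))"]
      summable_complex_of_real[of "\<lambda>i. real (Suc i) * norm (gln (a (Suc i)))"]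
    by (simp add: alpha_dual_def gsummable_iff gln_gcomplex_of_real_gmod gmult_def)
  show "a \<in> beta_dual slinf_Delta_G \<longleftrightarrow>
    a \<in> {a \<in> omega_G. gsummable (\<lambda>k. GExp (of_nat k) \<odot> a k) 1 \<and> gtail_abs_summable a}"
    using ball_slinf_Delta_G_iff[of "\<lambda>w. summable (\<lambda>i. gln (a (Suc i)) * w i)"]
      beta_dual_lipschitz[of "\<lambda>i. gln (a (Suc i))"]
    by (simp add: beta_dual_def gsummable_iff gmult_def gtail_abs_summable_iff)
  show "a \<in> gamma_dual slinf_Delta_G \<longleftrightarrow>
    a \<in> {a \<in> omega_G.
      bdd_above ((\<lambda>n. gmod (gsum (\<lambda>k. GExp (of_nat k) \<odot> a k) {1..n})) ` {1..}) \<and>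
      gtail_abs_summable a}"
    using ball_slinf_Delta_G_iff[of "\<lambda>w. Bseq (\<lambda>n. \<Sum>i<n. gln (a (Suc i)) * w i)"]
      gamma_dual_lipschitz[of "\<lambda>i. gln (a (Suc i))"]
    by (simp add: gamma_dual_def bdd_above_gmod_gsum_iff gmult_def gtail_abs_summable_iff del: One_nat_def)
qed

end
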